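(* Let $k\in\mathbb{N}$ and $\varepsilon>0$, and let $C=C(k,\varepsilon)$ be a sufficiently large constant. Then for all $p\geq \frac{C\log n}{n}$, with high probability there exists a subhypergraph $H\subseteq H^k_{n,p}$ with $\delta_{k-1}(H)\geq (1/2-\varepsilon)np$ that does not contain a perfect matching.
   Context: $H^k_{n,p}$ is the random $k$-uniform hypergraph on vertex set $[n]$ in which each $k$-subset of $[n]$ is an edge independently with probability $p$. "With high probability" means with probability tending to $1$ as $n\to\infty$. For a $k$-uniform hypergraph $H$ and a vertex set $X$, $d(X)$ is the number of edges of $H$ containing $X$, and $\delta_{k-1}(H)=\min\{d(X): X\subseteq V(H),|X|=k-1\}$. A perfect matching is a set of pairwise vertex-disjoint edges covering every vertex. *)

theory Defs
  imports "HOL-Probability.Probability" "HOL-Library.Ramsey"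
begin

text \<open>
  A hypergraph is represented by its vertex set \<open>V\<close> together with its edge set \<open>E\<close>.
  \<open>nsets V k\<close> is the set of all \<open>k\<close>-element subsets of \<open>V\<close>.
\<close>

definition random_hypergraph :: "nat \<Rightarrow> nat \<Rightarrow> real \<Rightarrow> nat set set pmf" where
  "random_hypergraph k n p =
     map_pmf (\<lambda>f. {e \<in> nsets {1..n} k. f e})
       (Pi_pmf (nsets {1..n} k) False (\<lambda>_. bernoulli_pmf p))"

definition set_degree :: "'a set set \<Rightarrow> 'a set \<Rightarrow> nat" where
  "set_degree E X = card {e \<in> E. X \<subseteq> e}"

text \<open>Only meaningful for \<open>j \<le> card V\<close>: otherwise \<open>Min\<close> is applied to the empty set.\<close>

definition min_degree :: "nat \<Rightarrow> 'a set \<Rightarrow> 'a set set \<Rightarrow> nat" where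
  "min_degree j V E = Min (set_degree E ` nsets V j)"

definition perfect_matching :: "'a set \<Rightarrow> 'a set set \<Rightarrow> 'a set set \<Rightarrow> bool" where
  "perfect_matching V E M \<longleftrightarrow> M \<subseteq> E \<and> pairwise disjnt M \<and> \<Union>M = V"

end

theory Submission
  imports Defs
begin

text \<open>
  Fix a set \<open>A\<close> of about \<open>n/2\<close> vertices with \<open>|A|\<close> odd, and let \<open>H\<close> consist of the edges that meet
  \<open>A\<close> in an even number of vertices. A perfect matching in \<open>H\<close> would split \<open>A\<close> into parts of even
  size. On the other hand, each \<open>(k-1)\<close>-set \<open>X\<close> extends to an edge of \<open>H\<close> by any vertex on one
  side of the partition, the side depending on the parity of \<open>|X \<inter> A|\<close>. So \<open>d(X)\<close> in \<open>H\<close> is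
  binomial with mean about \<open>np/2\<close>, and a Chernoff bound together with a union bound over the at
  most \<open>n^(k-1)\<close> sets \<open>X\<close> finishes the proof.
\<close>

lemma no_perfect_matching_if_even_traces:
  fixes V :: "'a set"
  assumes "finite V" "A \<subseteq> V" "odd (card A)" "\<And>e. e \<in> E \<Longrightarrow> even (card (e \<inter> A))"
  shows "\<not> perfect_matching V E M"
proof
  assume M: "perfect_matching V E M"
  hence sub: "M \<subseteq> E" and disj: "pairwise disjnt M" and V: "\<Union>M = V"
    by (auto simp: perfect_matching_def)
  have "finite M"
    using V \<open>finite V\<close> by (simp add: finite_UnionD)
  \<comment> \<open>The union is indexed by the edges of \<open>M\<close>, because several edges may
    share the empty trace on \<open>A\<close>.\<close>
  have "A = (\<Union>e\<in>M. e \<inter> A)"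
    using V \<open>A \<subseteq> V\<close> by blast
  hence "card A = card (\<Union>e\<in>M. e \<inter> A)"
    by simp
  also have "\<dots> = (\<Sum>e\<in>M. card (e \<inter> A))"
  proof (rule card_UN_disjoint)
    show "\<forall>e\<in>M. finite (e \<inter> A)"
      using finite_subset[OF \<open>A \<subseteq> V\<close> \<open>finite V\<close>] by blast
    show "\<forall>e\<in>M. \<forall>e'\<in>M. e \<noteq> e' \<longrightarrow> (e \<inter> A) \<inter> (e' \<inter> A) = {}"
      using disj by (fastforce simp: pairwise_def disjnt_def)
  qed fact
  also have "even \<dots>"
    using sub assms(4) by (intro dvd_sum) auto
  finally show False
    using assms(3) by simp
qed

text \<open>At most \<open>j\<close> vertices of the suitable side already lie in \<open>X\<close>;
  every other one gives its own extension. Putting \<open>j\<close> on the right avoids truncated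
  subtraction.\<close>

lemma card_even_trace_extensions_ge:
  fixes V :: "'a set"
  assumes "finite V" "A \<subseteq> V" "X \<in> nsets V j"
  shows "min (card A) (card (V - A)) \<le>
           card {e \<in> nsets V (Suc j). X \<subseteq> e \<and> even (card (e \<inter> A))} + j"
proof -
  have X: "X \<subseteq> V" "finite X" "card X = j"
    using assms(3) by (auto simp: nsets_def)
  have "finite A"
    using assms finite_subset by blast
  \<comment> \<open>A vertex outside \<open>A\<close> keeps the size of the trace and a new vertex
    of \<open>A\<close> raises it by one, so adding a vertex of \<open>S\<close> makes the trace
    even.\<close>
  define S where "S = (if even (card (X \<inter> A)) then V - A else A)"
  have S: "S \<subseteq> V"
    using \<open>A \<subseteq> V\<close> by (auto simp: S_def)
  have "insert v X \<in> {e \<in> nsets V (Suc j). X \<subseteq> e \<and> even (card (e \<inter> A))}" if "v \<in> S - X" for v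
  proof -
    have "even (card (insert v X \<inter> A))"
      using that X \<open>finite A\<close> by (auto simp: S_def Int_insert_left split: if_splits)
    thus ?thesis
      using that X S by (auto simp: nsets_def)
  qed
  hence "(\<lambda>v. insert v X) ` (S - X) \<subseteq> {e \<in> nsets V (Suc j). X \<subseteq> e \<and> even (card (e \<inter> A))}"
    by blast
  moreover have "inj_on (\<lambda>v. insert v X) (S - X)"
    by (auto simp: inj_on_def)
  moreover have "finite {e \<in> nsets V (Suc j). X \<subseteq> e \<and> even (card (e \<inter> A))}"
    using \<open>finite V\<close> by (simp add: finite_imp_finite_nsets)
  ultimately have "card (S - X) \<le> card {e \<in> nsets V (Suc j). X \<subseteq> e \<and> even (card (e \<inter> A))}"
    by (intro card_inj_on_le)
  moreover have "card S - card X \<le> card (S - X)"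
    using X(2) by (rule diff_card_le_card_Diff)
  moreover have "min (card A) (card (V - A)) \<le> card S"
    by (simp add: S_def)
  ultimately show ?thesis
    using X by linarith
qed

text \<open>Chernoff lower tail: Markov's inequality for \<open>exp (- l * N)\<close>, with
  \<open>N\<close> the number of chosen members of \<open>T\<close>. Independence factors the
  expectation, and each factor is bounded by \<open>1 - x \<le> exp (- x)\<close>. The parameter
  \<open>l\<close> stays free.\<close>

lemma prob_Pi_bernoulli_card_less_le:
  fixes p l t :: real
  assumes "finite E" "T \<subseteq> E" "0 \<le> p" "p \<le> 1" "0 \<le> l"
  shows "measure_pmf.prob (Pi_pmf E False (\<lambda>_. bernoulli_pmf p)) {f. real (card {e \<in> T. f e}) < t}
           \<le> exp (l * t - real (card T) * p * (1 - exp (- l)))"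
    (is "measure_pmf.prob ?P ?B \<le> _")
proof -
  \<comment> \<open>Outside \<open>T\<close> the factor is 1, so the product can run over all of
    \<open>E\<close>, the index set of the product measure.\<close>
  define g where "g = (\<lambda>e b. if e \<in> T \<and> b then exp (- l) else (1::real))"
  have fin: "finite (set_pmf ?P)"
    using \<open>finite E\<close> by (subst set_Pi_pmf) (auto intro!: finite_PiE_dflt)
  have prod_g: "(\<Prod>e\<in>E. g e (f e)) = exp (- l * real (card {e \<in> T. f e}))" for f
  proof -
    have "(\<Prod>e\<in>E. g e (f e)) = (\<Prod>e\<in>{e \<in> T. f e}. exp (- l))"
      using assms by (intro prod.mono_neutral_cong_right) (auto simp: g_def)
    thus ?thesis
      by (simp add: exp_of_nat_mult[symmetric] mult.commute)
  qed
  have "measure_pmf.prob ?P ?B = measure_pmf.expectation ?P (indicator ?B)"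
    by simp
  \<comment> \<open>Markov's inequality, pointwise: on \<open>?B\<close> the right-hand side is
    \<open>exp\<close> of a nonnegative number.\<close>
  also have "\<dots> \<le> measure_pmf.expectation ?P (\<lambda>f. exp (l * t) * (\<Prod>e\<in>E. g e (f e)))"
  proof (rule integral_mono)
    fix f
    show "indicator ?B f \<le> exp (l * t) * (\<Prod>e\<in>E. g e (f e))"
      using \<open>0 \<le> l\<close> by (auto simp: prod_g indicator_def mult_left_mono exp_add[symmetric])
  qed (use fin in \<open>auto intro: integrable_measure_pmf_finite\<close>)
  also have "\<dots> = exp (l * t) * (\<Prod>e\<in>E. measure_pmf.expectation (bernoulli_pmf p) (g e))"
    using \<open>finite E\<close> by (subst expectation_prod_Pi_pmf[symmetric])
      (auto intro: integrable_measure_pmf_finite simp: g_def)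
  also have "(\<Prod>e\<in>E. measure_pmf.expectation (bernoulli_pmf p) (g e)) =
      (\<Prod>e\<in>T. 1 - p * (1 - exp (- l)))"
    using assms by (intro prod.mono_neutral_cong_right) (auto simp: g_def algebra_simps)
  also have "\<dots> \<le> (\<Prod>e\<in>T. exp (- (p * (1 - exp (- l)))))"
  proof (rule prod_mono, intro conjI)
    have "p * (1 - exp (- l)) \<le> 1 * 1"
      using assms by (intro mult_mono) auto
    thus "0 \<le> 1 - p * (1 - exp (- l))"
      by simp
    show "1 - p * (1 - exp (- l)) \<le> exp (- (p * (1 - exp (- l))))"
      using exp_ge_add_one_self[of "- (p * (1 - exp (- l)))"] by simp
  qed
  also have "exp (l * t) * (\<Prod>e\<in>T. exp (- (p * (1 - exp (- l))))) =
      exp (l * t - real (card T) * p * (1 - exp (- l)))"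
    by (simp add: exp_of_nat_mult[symmetric] exp_add[symmetric] algebra_simps)
  finally show ?thesis
    by simp
qed

text \<open>The second-order term matters: in the Chernoff exponent it costs only a quarter of the
  gain \<open>\<epsilon>\<^sup>2 * n * p\<close>.\<close>

lemma one_minus_exp_uminus_ge:
  fixes x :: real
  assumes "0 \<le> x"
  shows "x - x\<^sup>2 / 2 \<le> 1 - exp (- x)"
proof -
  have pos: "0 \<le> 1 - x + x\<^sup>2 / 2"
    using zero_le_power2[of "x - 1"] by (simp add: power2_eq_square algebra_simps)
  \<comment> \<open>Difference of squares:
    \<open>(1 + x\<^sup>2/2)\<^sup>2 - x\<^sup>2 = 1 + x^4/4\<close>.\<close>
  have "1 \<le> 1 + (x\<^sup>2)\<^sup>2 / 4"
    by simp
  also have "\<dots> = (1 + x + x\<^sup>2 / 2) * (1 - x + x\<^sup>2 / 2)"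
    by (simp add: power2_eq_square field_simps)
  also have "\<dots> \<le> exp x * (1 - x + x\<^sup>2 / 2)"
    using exp_lower_Taylor_quadratic[OF assms] pos by (intro mult_right_mono) auto
  finally show ?thesis
    by (simp add: exp_minus field_simps)
qed

lemma card_nsets_le_power: "card (nsets A j) \<le> card A ^ j"
  by (cases "j \<le> card A") (auto simp: card_nsets binomial_le_pow binomial_eq_0)

text \<open>Chernoff with \<open>l = \<epsilon>\<close> and
  \<open>card T \<ge> n/2 - (j + 1)\<close>: the main terms \<open>\<epsilon> * n * p / 2\<close>
  cancel, leaving \<open>- \<epsilon>\<^sup>2 * n * p + \<epsilon>\<^sup>2 * n * p / 4\<close>. The
  deficit \<open>j + 1\<close> costs at most \<open>(j + 1) * \<epsilon>\<close>, as
  \<open>p \<le> 1\<close>.\<close>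

lemma prob_even_trace_degree_less_le:
  fixes p \<epsilon> :: real
  assumes "0 \<le> p" "p \<le> 1" "0 < \<epsilon>" "X \<in> nsets {1..n} j" "A \<subseteq> {1..n}"
    and "real n / 2 - 1 \<le> real (card A)" "real n / 2 - 1 \<le> real (card ({1..n} - A))"
  shows "measure_pmf.prob (random_hypergraph (Suc j) n p)
           {G. real (set_degree {e \<in> G. even (card (e \<inter> A))} X) < (1/2 - \<epsilon>) * real n * p}
         \<le> exp (real (Suc j) * \<epsilon> - 3/4 * \<epsilon>\<^sup>2 * (real n * p))"
    (is "measure_pmf.prob _ ?B \<le> _")
proof -
  define E where "E = nsets {1..n} (Suc j)"
  define T where "T = {e \<in> E. X \<subseteq> e \<and> even (card (e \<inter> A))}"
  let ?t = "(1/2 - \<epsilon>) * real n * p"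
  have "finite E"
    by (simp add: E_def finite_imp_finite_nsets)
  have T_eq: "{e \<in> {e \<in> {e \<in> E. f e}. even (card (e \<inter> A))}. X \<subseteq> e} = {e \<in> T. f e}" for f
    by (auto simp: T_def)
  have "measure_pmf.prob (random_hypergraph (Suc j) n p) ?B =
      measure_pmf.prob (Pi_pmf E False (\<lambda>_. bernoulli_pmf p)) {f. real (card {e \<in> T. f e}) < ?t}"
    unfolding random_hypergraph_def E_def[symmetric] set_degree_def measure_map_pmf vimage_def
    by (simp only: mem_Collect_eq T_eq[unfolded mem_Collect_eq])
  also have "\<dots> \<le> exp (\<epsilon> * ?t - real (card T) * p * (1 - exp (- \<epsilon>)))"
    using assms \<open>finite E\<close> by (intro prob_Pi_bernoulli_card_less_le) (auto simp: T_def)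
  also have "\<dots> \<le> exp (real (Suc j) * \<epsilon> - 3/4 * \<epsilon>\<^sup>2 * (real n * p))"
  proof -
    have "min (card A) (card ({1..n} - A)) \<le> card T + j"
      using card_even_trace_extensions_ge[of "{1..n}" A X j] assms by (simp add: T_def E_def)
    hence "real n / 2 - real (Suc j) \<le> real (card T)"
      using assms(6,7) by linarith
    moreover have q: "0 \<le> 1 - exp (- \<epsilon>)" "1 - exp (- \<epsilon>) \<le> \<epsilon>"
      using \<open>0 < \<epsilon>\<close> exp_ge_add_one_self[of "- \<epsilon>"] by auto
    ultimately have "(real n / 2 - real (Suc j)) * (p * (1 - exp (- \<epsilon>))) \<le>
        real (card T) * (p * (1 - exp (- \<epsilon>)))"
      using assms by (intro mult_right_mono) auto
    moreover have "real n / 2 * p * (\<epsilon> - \<epsilon>\<^sup>2 / 2) \<le> real n / 2 * p * (1 - exp (- \<epsilon>))"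
      using assms by (intro mult_left_mono one_minus_exp_uminus_ge) auto
    moreover have "real (Suc j) * (p * (1 - exp (- \<epsilon>))) \<le> real (Suc j) * (1 * \<epsilon>)"
      using assms q by (intro mult_left_mono mult_mono) auto
    ultimately have "\<epsilon> * ?t - real (card T) * p * (1 - exp (- \<epsilon>)) \<le>
        real (Suc j) * \<epsilon> - 3/4 * \<epsilon>\<^sup>2 * (real n * p)"
      by (simp add: algebra_simps power2_eq_square)
    thus ?thesis
      by simp
  qed
  finally show ?thesis .
qed

lemma prob_even_trace_min_degree_less_le:
  fixes p \<epsilon> :: real
  assumes "0 \<le> p" "p \<le> 1" "0 < \<epsilon>" "j \<le> n" "A \<subseteq> {1..n}"
    and "real n / 2 - 1 \<le> real (card A)" "real n / 2 - 1 \<le> real (card ({1..n} - A))"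
  shows "measure_pmf.prob (random_hypergraph (Suc j) n p)
           {G. real (min_degree j {1..n} {e \<in> G. even (card (e \<inter> A))}) < (1/2 - \<epsilon>) * real n * p}
         \<le> real n ^ j * exp (real (Suc j) * \<epsilon> - 3/4 * \<epsilon>\<^sup>2 * (real n * p))"
    (is "measure_pmf.prob ?R ?B \<le> _ * ?b")
proof -
  let ?N = "nsets {1..n} j"
  let ?D = "\<lambda>X. {G. real (set_degree {e \<in> G. even (card (e \<inter> A))} X) < (1/2 - \<epsilon>) * real n * p}"
  have fin: "finite ?N"
    by (simp add: finite_imp_finite_nsets)
  \<comment> \<open>Needed so that the \<open>Min\<close> in \<open>min_degree\<close> is attained;
    a small minimum then yields a set \<open>X\<close> of small degree.\<close>
  have "?N \<noteq> {}"
    using \<open>j \<le> n\<close> by (simp add: nsets_eq_empty_iff)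
  have "G \<in> (\<Union>X\<in>?N. ?D X)" if "G \<in> ?B" for G
  proof -
    have "min_degree j {1..n} {e \<in> G. even (card (e \<inter> A))}
        \<in> set_degree {e \<in> G. even (card (e \<inter> A))} ` ?N"
      unfolding min_degree_def using fin \<open>?N \<noteq> {}\<close> by (intro Min_in) auto
    thus ?thesis
      using that by fastforce
  qed
  hence "measure_pmf.prob ?R ?B \<le> measure_pmf.prob ?R (\<Union>X\<in>?N. ?D X)"
    by (intro measure_pmf.finite_measure_mono) auto
  also have "\<dots> \<le> (\<Sum>X\<in>?N. measure_pmf.prob ?R (?D X))"
    using fin by (intro measure_pmf.finite_measure_subadditive_finite) auto
  also have "\<dots> \<le> (\<Sum>X\<in>?N. ?b)"
    using assms by (intro sum_mono prob_even_trace_degree_less_le) auto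
  also have "\<dots> = real (card ?N) * ?b"
    by simp
  also have "\<dots> \<le> real n ^ j * ?b"
    using card_nsets_le_power[of "{1..n}" j] by (intro mult_right_mono) (auto simp flip: of_nat_power)
  finally show ?thesis .
qed

theorem theorem1p2:
  fixes k :: nat and \<epsilon> :: real
  assumes "k \<ge> 1" and "\<epsilon> > 0"
  shows "\<exists>C\<^sub>0>0. \<forall>C\<ge>C\<^sub>0. \<forall>p :: nat \<Rightarrow> real.
    (\<forall>n. 0 \<le> p n \<and> p n \<le> 1) \<longrightarrow>
    (\<forall>\<^sub>F n in sequentially. p n \<ge> C * ln (real n) / real n) \<longrightarrow>
    (\<lambda>n. measure_pmf.prob (random_hypergraph k n (p n))
       {G. \<exists>H\<subseteq>G. real (min_degree (k - 1) {1..n} H) \<ge> (1/2 - \<epsilon>) * real n * p n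
               \<and> \<not> (\<exists>M. perfect_matching {1..n} H M)}) \<longlonglongrightarrow> 1"
proof -
  obtain j where j: "k = Suc j"
    using \<open>k \<ge> 1\<close> by (cases k) auto
  \<comment> \<open>Chosen so that \<open>3/4 * \<epsilon>\<^sup>2 * C\<^sub>0 = k\<close>: each
    failure probability is then of order \<open>n^(-k)\<close>, and the union bound over at most
    \<open>n^(k-1)\<close> sets leaves order \<open>1/n\<close>.\<close>
  define C\<^sub>0 where "C\<^sub>0 = 4 * real k / (3 * \<epsilon>\<^sup>2)"
  have "C\<^sub>0 > 0"
    using assms by (simp add: C\<^sub>0_def)
  moreover have "(\<lambda>n. measure_pmf.prob (random_hypergraph k n (p n)) (Q n)) \<longlonglongrightarrow> 1"
    if "C \<ge> C\<^sub>0" and p: "\<forall>n. 0 \<le> p n \<and> p n \<le> 1"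
      and large: "\<forall>\<^sub>F n in sequentially. p n \<ge> C * ln (real n) / real n"
      and Q: "Q = (\<lambda>n. {G. \<exists>H\<subseteq>G. real (min_degree (k - 1) {1..n} H) \<ge> (1/2 - \<epsilon>) * real n * p n
               \<and> \<not> (\<exists>M. perfect_matching {1..n} H M)})"
    for C and p :: "nat \<Rightarrow> real" and Q
  proof (rule tendsto_sandwich)
    show "(\<lambda>n. 1 - exp (real k * \<epsilon>) / real n) \<longlonglongrightarrow> 1"
      using tendsto_diff[OF tendsto_const lim_const_over_n[of "exp (real k * \<epsilon>)"], of 1] by simp
    show "(\<lambda>n. 1 :: real) \<longlonglongrightarrow> 1"
      by simp
    show "\<forall>\<^sub>F n in sequentially. measure_pmf.prob (random_hypergraph k n (p n)) (Q n) \<le> 1"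
      by simp
    show "\<forall>\<^sub>F n in sequentially. 1 - exp (real k * \<epsilon>) / real n \<le>
        measure_pmf.prob (random_hypergraph k n (p n)) (Q n)"
      using large eventually_ge_at_top[of k]
    proof eventually_elim
      case (elim n)
      hence n: "n \<ge> 1" "j \<le> n"
        using j by auto
      let ?R = "random_hypergraph k n (p n)"
      \<comment> \<open>An odd number within 1 of \<open>n/2\<close>. The extreme case is
        \<open>n\<close> divisible by 4, where the other side has exactly \<open>n/2 - 1\<close>
        vertices.\<close>
      define a where "a = 2 * (n div 4) + 1"
      have "odd a" "a \<le> n"
        using n by (auto simp: a_def)
      have a: "real n / 2 - 1 \<le> real a" "real n / 2 - 1 \<le> real (n - a)"
        unfolding a_def by linarith+
      define A where "A = {1..a}"
      have A: "A \<subseteq> {1..n}" "card A = a" "card ({1..n} - A) = n - a"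
        using \<open>a \<le> n\<close> by (auto simp: A_def card_Diff_subset)
      let ?B = "{G. real (min_degree j {1..n} {e \<in> G. even (card (e \<inter> A))})
                  < (1/2 - \<epsilon>) * real n * p n}"
      \<comment> \<open>The witness \<open>H\<close> is the set of edges of \<open>G\<close> with
        even trace on \<open>A\<close>. It never has a perfect matching, so only the degree
        condition can fail.\<close>
      have "- ?B \<subseteq> Q n"
      proof
        fix G
        assume "G \<in> - ?B"
        moreover have "\<not> perfect_matching {1..n} {e \<in> G. even (card (e \<inter> A))} M" for M
          using A \<open>odd a\<close> by (intro no_perfect_matching_if_even_traces[where A = A]) auto
        ultimately show "G \<in> Q n"
          unfolding Q using j by (auto intro!: exI[of _ "{e \<in> G. even (card (e \<inter> A))}"])
      qed
      hence "1 - measure_pmf.prob ?R ?B \<le> measure_pmf.prob ?R (Q n)"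
        by (subst measure_pmf.prob_compl[symmetric, simplified])
          (auto intro!: measure_pmf.finite_measure_mono simp: Compl_eq_Diff_UNIV)
      moreover have "measure_pmf.prob ?R ?B \<le>
          real n ^ j * exp (real k * \<epsilon> - 3/4 * \<epsilon>\<^sup>2 * (real n * p n))"
        unfolding j using p n A a \<open>\<epsilon> > 0\<close>
        by (intro prob_even_trace_min_degree_less_le) auto
      moreover have "\<dots> \<le> exp (real k * \<epsilon>) / real n"
      proof -
        \<comment> \<open>Here \<open>n \<ge> 1\<close> makes the logarithm nonnegative, so
          \<open>C\<close> may be lowered to \<open>C\<^sub>0\<close>.\<close>
        have "C\<^sub>0 * ln (real n) \<le> C * ln (real n)"
          using \<open>C \<ge> C\<^sub>0\<close> n by (intro mult_right_mono) auto
        also have "\<dots> \<le> real n * p n"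
          using elim n by (simp add: field_simps)
        finally have "3/4 * \<epsilon>\<^sup>2 * (C\<^sub>0 * ln (real n)) \<le> 3/4 * \<epsilon>\<^sup>2 * (real n * p n)"
          by (intro mult_left_mono) auto
        hence "real k * ln (real n) \<le> 3/4 * \<epsilon>\<^sup>2 * (real n * p n)"
          using \<open>\<epsilon> > 0\<close> by (simp add: C\<^sub>0_def)
        hence "exp (real k * \<epsilon> - 3/4 * \<epsilon>\<^sup>2 * (real n * p n)) \<le>
            exp (real k * \<epsilon> - real k * ln (real n))"
          by simp
        also have "\<dots> = exp (real k * \<epsilon>) / real n ^ k"
          using n by (simp add: exp_diff exp_of_nat_mult)
        finally have "real n ^ j * exp (real k * \<epsilon> - 3/4 * \<epsilon>\<^sup>2 * (real n * p n)) \<le>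
            real n ^ j * (exp (real k * \<epsilon>) / real n ^ k)"
          by (intro mult_left_mono) auto
        also have "\<dots> = exp (real k * \<epsilon>) / real n"
          using n by (simp add: j)
        finally show ?thesis .
      qed
      ultimately show ?case
        by linarith
    qed
  qed
  ultimately show ?thesis
    by blast
qed

end
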